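(* Let $\mathcal{M}$ be a regular matroid of rank $r>0$ on $n$ elements and let $M\in\mathbb{Z}^{r\times n}$ be any full-rank weakly unimodular matrix representing $\mathcal{M}$. Then: (i) $\mathcal{P}_M$ is centrally symmetric; (ii) $\dim(\mathcal{P}_M)=\mathrm{rk}(\mathcal{M})$; (iii) $\mathcal{P}_M$ is reflexive; (iv) $\mathcal{P}_M$ is terminal, i.e., the only points of $\mathcal{P}_M$ with integer coordinates are its vertices and the origin; (v) the number of vertices of $\mathcal{P}_M$ is twice the number of atoms (rank-one flats) of the lattice of flats of $\mathcal{M}$; in particular, if $\mathcal{M}$ is simple, every antipodal pair of vertices of $\mathcal{P}_M$ corresponds to an element of the ground set of $\mathcal{M}$ (namely the vertices are exactly the $2n$ columns $\pm M\mathbf{e}_i$ of $[M\mid -M]$).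
   Context: A matrix $M\in\mathbb{Z}^{r\times n}$ with $0<r\le n$ is full-rank weakly unimodular if it has rank $r$ and every $r\times r$ minor lies in $\{0,\pm1\}$. $M$ represents the matroid $\mathcal{M}$ if the matroid on $[n]$ whose independent sets are the sets of linearly independent columns of $M$ is isomorphic to $\mathcal{M}$; a matroid of positive rank is regular if it has such a representation. $\mathcal{P}_M\subseteq\mathbb{R}^r$ is the convex hull of the columns of $[M\mid -M]$ (this is the generalized symmetric edge polytope of $\mathcal{M}$, well defined up to unimodular equivalence fixing the origin). A full-dimensional lattice polytope $P$ with the origin in its interior is reflexive if its polar $P^\Delta=\{\mathbf{u}:\mathbf{u}\cdot\mathbf{x}\le 1\ \forall \mathbf{x}\in P\}$ is a lattice polytope. *)

theory Defs
  imports "HOL-Analysis.Analysis"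
begin

locale matroid =
  fixes E :: "'a set" and I :: "'a set set"
  assumes finite_ground: "finite E"
    and indep_subset_ground: "X \<in> I \<Longrightarrow> X \<subseteq> E"
    and indep_empty: "{} \<in> I"
    and indep_mono: "X \<in> I \<Longrightarrow> Y \<subseteq> X \<Longrightarrow> Y \<in> I"
    and indep_exchange: "X \<in> I \<Longrightarrow> Y \<in> I \<Longrightarrow> card X < card Y \<Longrightarrow> \<exists>y\<in>Y - X. insert y X \<in> I"

definition matroid_rank :: "'a set set \<Rightarrow> 'a set \<Rightarrow> nat" where
  "matroid_rank I X = Max (card ` {Y \<in> I. Y \<subseteq> X})"

definition flat :: "'a set \<Rightarrow> 'a set set \<Rightarrow> 'a set \<Rightarrow> bool" where
  "flat E I F \<longleftrightarrow> F \<subseteq> E \<and> (\<forall>x\<in>E - F. matroid_rank I F < matroid_rank I (insert x F))"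

definition flat_atoms :: "'a set \<Rightarrow> 'a set set \<Rightarrow> 'a set set" where
  "flat_atoms E I = {F. flat E I F \<and> matroid_rank I F = 1}"

definition matroid_loop :: "'a set \<Rightarrow> 'a set set \<Rightarrow> 'a \<Rightarrow> bool" where
  "matroid_loop E I x \<longleftrightarrow> x \<in> E \<and> {x} \<notin> I"

definition matroid_parallel :: "'a set \<Rightarrow> 'a set set \<Rightarrow> 'a \<Rightarrow> 'a \<Rightarrow> bool" where
  "matroid_parallel E I x y \<longleftrightarrow>
     x \<in> E \<and> y \<in> E \<and> x \<noteq> y \<and> {x} \<in> I \<and> {y} \<in> I \<and> {x, y} \<notin> I"

definition simple_matroid :: "'a set \<Rightarrow> 'a set set \<Rightarrow> bool" where
  "simple_matroid E I \<longleftrightarrow> (\<forall>x. \<not> matroid_loop E I x) \<and> (\<forall>x y. \<not> matroid_parallel E I x y)"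

definition matroid_isomorphism ::
    "('a \<Rightarrow> 'b) \<Rightarrow> 'a set \<Rightarrow> 'a set set \<Rightarrow> 'b set \<Rightarrow> 'b set set \<Rightarrow> bool" where
  "matroid_isomorphism \<phi> E I E' I' \<longleftrightarrow>
     bij_betw \<phi> E E' \<and> (\<forall>X\<subseteq>E. X \<in> I \<longleftrightarrow> \<phi> ` X \<in> I')"

abbreviation real_matrix :: "int ^ 'n::finite ^ 'r::finite \<Rightarrow> real ^ 'n ^ 'r" where
  "real_matrix M \<equiv> map_matrix real_of_int M"

text \<open>
  A maximal minor is obtained by listing \<open>r\<close> distinct columns. The index type carries no order;
  reordering the columns changes the minor only by a sign, which membership in \<open>{-1, 0, 1}\<close>
  does not see.
\<close>

definition full_rank_weakly_unimodular :: "int ^ 'n::finite ^ 'r::finite \<Rightarrow> bool" where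
  "full_rank_weakly_unimodular M \<longleftrightarrow>
     CARD('r) \<le> CARD('n) \<and>
     rank (real_matrix M) = CARD('r) \<and>
     (\<forall>f :: 'r \<Rightarrow> 'n. inj f \<longrightarrow> det (\<chi> i j. M $ i $ f j) \<in> {-1, 0, 1})"

text \<open>
  Independence is that of the family of columns indexed by \<open>S\<close>, so two equal columns with
  different indices are dependent.
\<close>

definition column_indep :: "int ^ 'n::finite ^ 'r::finite \<Rightarrow> 'n set set" where
  "column_indep M =
     {S. inj_on (\<lambda>j. column j (real_matrix M)) S \<and>
         independent ((\<lambda>j. column j (real_matrix M)) ` S)}"

definition represents :: "int ^ 'n::finite ^ 'r::finite \<Rightarrow> 'a set \<Rightarrow> 'a set set \<Rightarrow> bool" where
  "represents M E I \<longleftrightarrow> (\<exists>\<phi>. matroid_isomorphism \<phi> E I UNIV (column_indep M))"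

text \<open>
  The type arguments give the format of the representing matrix. They are determined by the
  matroid up to a bijection of index types: a full-rank weakly unimodular \<open>r \<times> n\<close> matrix can only
  represent a matroid of rank \<open>r\<close> on \<open>n\<close> elements.
\<close>

definition regular_matroid ::
    "'r::finite itself \<Rightarrow> 'n::finite itself \<Rightarrow> 'a set \<Rightarrow> 'a set set \<Rightarrow> bool" where
  "regular_matroid tr tn E I \<longleftrightarrow>
     matroid E I \<and> 0 < matroid_rank I E \<and>
     (\<exists>M :: int ^ 'n ^ 'r. full_rank_weakly_unimodular M \<and> represents M E I)"

definition integer_points :: "(real ^ 'r::finite) set" where
  "integer_points = {x. \<forall>i. x $ i \<in> \<int>}"

definition lattice_polytope :: "(real ^ 'r::finite) set \<Rightarrow> bool" where
  "lattice_polytope P \<longleftrightarrow> (\<exists>V. finite V \<and> V \<subseteq> integer_points \<and> P = convex hull V)"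

definition polar_dual :: "(real ^ 'r::finite) set \<Rightarrow> (real ^ 'r) set" where
  "polar_dual P = {u. \<forall>x\<in>P. u \<bullet> x \<le> 1}"

definition reflexive_polytope :: "(real ^ 'r::finite) set \<Rightarrow> bool" where
  "reflexive_polytope P \<longleftrightarrow>
     lattice_polytope P \<and> aff_dim P = int CARD('r) \<and> 0 \<in> interior P \<and>
     lattice_polytope (polar_dual P)"

definition centrally_symmetric :: "(real ^ 'r::finite) set \<Rightarrow> bool" where
  "centrally_symmetric P \<longleftrightarrow> uminus ` P = P"

definition polytope_vertices :: "(real ^ 'r::finite) set \<Rightarrow> (real ^ 'r) set" where
  "polytope_vertices P = {v. v extreme_point_of P}"

definition terminal_polytope :: "(real ^ 'r::finite) set \<Rightarrow> bool" where
  "terminal_polytope P \<longleftrightarrow> P \<inter> integer_points = insert 0 (polytope_vertices P)"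

definition sym_matrix :: "int ^ 'n::finite ^ 'r::finite \<Rightarrow> int ^ ('n + 'n) ^ 'r" where
  "sym_matrix M = (\<chi> i j. case j of Inl k \<Rightarrow> M $ i $ k | Inr k \<Rightarrow> - (M $ i $ k))"

definition sym_edge_polytope :: "int ^ 'n::finite ^ 'r::finite \<Rightarrow> (real ^ 'r) set" where
  "sym_edge_polytope M = convex hull (columns (real_matrix (sym_matrix M)))"

end

theory Submission
  imports Defs
begin

text \<open>
  Let \<open>S\<close> be the set of columns of \<open>[M | -M]\<close>. A basis of \<open>\<real>\<^sup>r\<close> contained in \<open>S\<close> has determinant
  \<open>\<plusminus>1\<close>, so by Cramer's rule a vector having integral inner products with it is integral. At a
  vertex of the polar the tight constraints span \<open>\<real>\<^sup>r\<close>, and all of them have right-hand side \<open>1\<close>;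
  hence the polar is a lattice polytope. Consequently a nonzero integer point \<open>x\<close> of the convex hull
  of \<open>W \<subseteq> S\<close> lies on a hyperplane \<open>u \<bullet> x = 1\<close> supporting the hull. By Caratheodory, \<open>x\<close> is a convex
  combination of affinely independent elements of \<open>W\<close> on this hyperplane; as it misses the origin
  they are linearly independent, so the coefficients are integral and \<open>x \<in> W\<close>. For \<open>W = S\<close> this is
  terminality; for \<open>W\<close> the set of vertices it shows that every nonzero column is a vertex. Finally,
  parallel columns are integer multiples of each other and hence agree up to sign, which identifies
  antipodal pairs of vertices with parallel classes, that is, with atoms.
\<close>

section \<open>Linear algebra and cardinalities\<close>

lemma eq_minus_self_iff: "v = - v \<longleftrightarrow> v = 0" for v :: "'v::real_vector"
proof
  assume "v = - v"
  then have "2 *\<^sub>R v = 0"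
    by (metis scaleR_2 add.right_inverse)
  then show "v = 0"
    by simp
qed simp

lemma antipodal_pair_eq_iff: "{v, - v} = {w, - w} \<longleftrightarrow> v = w \<or> v = - w"
  for v w :: "'v::real_vector"
  by (auto simp: doubleton_eq_iff)

lemma card_eq_twice_card_antipodal_pairs:
  fixes V :: "'v::real_vector set"
  assumes "finite V" and symmetric: "\<And>v. v \<in> V \<Longrightarrow> - v \<in> V" and "0 \<notin> V"
  shows "card V = 2 * card {{v, - v} |v. v \<in> V}"
proof -
  let ?C = "{{v, - v} |v. v \<in> V}"
  have union: "\<Union> ?C = V"
    using symmetric by auto
  have "2 * card ?C = card (\<Union> ?C)"
  proof (rule card_partition)
    show "finite ?C" "finite (\<Union> ?C)"
      using \<open>finite V\<close> union by simp_all
    fix c assume "c \<in> ?C"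
    then obtain v where "v \<in> V" "c = {v, - v}"
      by blast
    moreover have "v \<noteq> - v"
      using \<open>v \<in> V\<close> \<open>0 \<notin> V\<close> eq_minus_self_iff by metis
    ultimately show "card c = 2"
      by simp
  qed auto
  then show ?thesis
    using union by simp
qed

lemma card_image_eq_of_same_kernel:
  assumes "\<And>x y. x \<in> A \<Longrightarrow> y \<in> A \<Longrightarrow> f x = f y \<longleftrightarrow> g x = g y"
  shows "card (f ` A) = card (g ` A)"
proof -
  let ?H = "(\<lambda>x. (f x, g x)) ` A"
  have "inj_on fst ?H" "inj_on snd ?H"
    using assms by (auto simp: inj_on_def)
  then have "card (fst ` ?H) = card (snd ` ?H)"
    by (simp only: card_image)
  then show ?thesis
    by (simp add: image_image)
qed

lemma independent_pair_iff:
  fixes v w :: "'v::real_vector"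
  assumes "v \<noteq> w"
  shows "independent {v, w} \<longleftrightarrow> w \<noteq> 0 \<and> (\<forall>k. v \<noteq> k *\<^sub>R w)"
proof -
  have "independent {v, w} \<longleftrightarrow> w \<noteq> 0 \<and> v \<notin> span {w}"
    using assms by (simp add: independent_insert)
  then show ?thesis
    unfolding span_singleton by blast
qed

lemma det_in_Ints:
  fixes A :: "'a::comm_ring_1 ^ 'n::finite ^ 'n"
  assumes "\<And>i j. A $ i $ j \<in> \<int>"
  shows "det A \<in> \<int>"
  unfolding det_def using assms by (auto intro!: Ints_sum Ints_mult Ints_prod)

lemma det_map_matrix_of_int:
  "det (map_matrix of_int A) = (of_int (det A) :: 'a::comm_ring_1)"
  by (simp add: det_def map_matrix_def)

lemma det_rows_up_to_sign:
  fixes f g :: "'n::finite \<Rightarrow> 'a::comm_ring_1 ^ 'n"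
  assumes "\<And>i. g i = f i \<or> g i = - f i"
  shows "det (\<chi> i. g i) = det (\<chi> i. f i) \<or> det (\<chi> i. g i) = - det (\<chi> i. f i)"
proof -
  define a :: "'n \<Rightarrow> 'a" where "a i = (if g i = f i then 1 else - 1)" for i
  have "prod a A = 1 \<or> prod a A = - 1" if "finite A" for A
    using that by (induction A rule: finite_induct) (auto simp: a_def)
  then have "prod a UNIV = 1 \<or> prod a UNIV = - 1"
    by simp
  moreover have "g i = a i *s f i" for i
    using assms[of i] by (auto simp: a_def vec_eq_iff)
  then have "det (\<chi> i. g i) = prod a UNIV * det (\<chi> i. f i)"
    by (simp add: det_rows_mul)
  ultimately show ?thesis
    by auto
qed

lemma inner_integer_points:
  "u \<in> integer_points \<Longrightarrow> x \<in> integer_points \<Longrightarrow> u \<bullet> x \<in> \<int>"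
  by (auto simp: inner_vec_def integer_points_def intro!: Ints_sum Ints_mult)

lemma integral_solution_of_unimodular:
  fixes A :: "real ^ 'r::finite ^ 'r"
  assumes entries: "\<And>i j. A $ i $ j \<in> \<int>" and det: "det A \<in> {-1, 1}"
    and rhs: "A *v x \<in> integer_points"
  shows "x \<in> integer_points"
proof -
  have cramer_formula: "x = (\<chi> k. det (\<chi> i j. if j = k then (A *v x) $ i else A $ i $ j) / det A)"
    using cramer[of A x "A *v x"] det by auto
  have "det (\<chi> i j. if j = k then (A *v x) $ i else A $ i $ j) \<in> \<int>" for k
    by (rule det_in_Ints) (use entries rhs in \<open>auto simp: integer_points_def\<close>)
  then have "x $ k \<in> \<int>" for k
    using det by (subst cramer_formula) auto
  then show ?thesis
    by (simp add: integer_points_def)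
qed

section \<open>Convex hulls and polars\<close>

lemma convex_hull_Caratheodory_affine_independent:
  fixes W :: "'v::euclidean_space set"
  assumes "x \<in> convex hull W"
  obtains T where "T \<subseteq> W" "\<not> affine_dependent T" "x \<in> convex hull T"
proof -
  define carries where "carries T \<longleftrightarrow> finite T \<and> T \<subseteq> W \<and> x \<in> convex hull T" for T
  have "\<exists>T. carries T"
    using assms unfolding caratheodory[of W] carries_def by blast
  then obtain T where T: "carries T" and minimal: "\<And>T'. carries T' \<Longrightarrow> card T \<le> card T'"
    using ex_has_least_nat[of carries _ card] by blast
  obtain T' where "finite T'" "T' \<subseteq> T" "int (card T') \<le> aff_dim T + 1" "x \<in> convex hull T'"
    using T unfolding carries_def caratheodory_aff_dim[of T] by blast
  moreover from this have "card T \<le> card T'"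
    using T by (intro minimal) (auto simp: carries_def)
  ultimately have "int (card T) - 1 \<le> aff_dim T"
    by linarith
  moreover have "aff_dim T \<le> int (card T) - 1"
    using T by (intro aff_dim_le_card) (simp add: carries_def)
  ultimately have "\<not> affine_dependent T"
    using T by (auto simp: affine_independent_iff_card carries_def)
  then show thesis
    using that T by (auto simp: carries_def)
qed

lemma affine_independent_in_hyperplane_imp_independent:
  fixes T :: "'v::euclidean_space set"
  assumes "\<not> affine_dependent T" and hyperplane: "\<And>t. t \<in> T \<Longrightarrow> u \<bullet> t = b" and "b \<noteq> 0"
  shows "independent T"
proof
  have "finite T"
    using assms(1) by (rule aff_independent_finite)
  assume "dependent T"
  then obtain m where relation: "(\<Sum>t\<in>T. m t *\<^sub>R t) = 0" "\<exists>t\<in>T. m t \<noteq> 0"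
    using \<open>finite T\<close> by (auto simp: dependent_finite)
  have "sum m T * b = (\<Sum>t\<in>T. m t * (u \<bullet> t))"
    using hyperplane by (simp add: sum_distrib_right)
  also have "\<dots> = u \<bullet> (\<Sum>t\<in>T. m t *\<^sub>R t)"
    by (simp add: inner_sum_right)
  finally have "sum m T = 0"
    using relation(1) \<open>b \<noteq> 0\<close> by simp
  then show False
    using assms(1) relation \<open>finite T\<close> by (auto simp: affine_dependent_explicit_finite)
qed

lemma convex_hull_Int_supporting_hyperplane:
  fixes W :: "'v::euclidean_space set"
  assumes "compact W" and bound: "\<And>w. w \<in> W \<Longrightarrow> u \<bullet> w \<le> b"
    and "x \<in> convex hull W" "u \<bullet> x = b"
  shows "x \<in> convex hull {w \<in> W. u \<bullet> w = b}"
proof -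
  let ?F = "convex hull W \<inter> {y. u \<bullet> y = b}"
  have "convex hull W \<subseteq> {y. u \<bullet> y \<le> b}"
    using bound by (intro hull_minimal convex_halfspace_le) auto
  then have "?F face_of convex hull W"
    by (intro face_of_Int_supporting_hyperplane_le) auto
  then obtain W' where "W' \<subseteq> W" "?F = convex hull W'"
    using face_of_convex_hull_subset[OF \<open>compact W\<close>] by metis
  moreover from this have "W' \<subseteq> {w \<in> W. u \<bullet> w = b}"
    using hull_subset[of W' convex] by blast
  ultimately show ?thesis
    using assms(3,4) hull_mono[of W' "{w \<in> W. u \<bullet> w = b}" convex] by blast
qed

lemma integral_convex_combination_in_set:
  fixes T :: "'v::real_vector set"
  assumes "finite T" and nonneg: "\<And>t. t \<in> T \<Longrightarrow> 0 \<le> c t" and integral: "\<And>t. t \<in> T \<Longrightarrow> c t \<in> \<int>"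
    and total: "sum c T = (1 :: real)"
  shows "(\<Sum>t\<in>T. c t *\<^sub>R t) \<in> T"
proof -
  obtain t where t: "t \<in> T" "c t \<noteq> 0"
    using total by (metis sum.neutral zero_neq_one)
  then have "1 \<le> c t"
    using nonneg[of t] integral[of t] Ints_nonzero_abs_ge1[of "c t"] by simp
  moreover have "sum c T = c t + sum c (T - {t})"
    using \<open>finite T\<close> t by (simp add: sum.remove)
  moreover have "0 \<le> sum c (T - {t})"
    using nonneg by (intro sum_nonneg) auto
  ultimately have "c t = 1" "sum c (T - {t}) = 0"
    using total by linarith+
  then have "c s = 0" if "s \<in> T - {t}" for s
    using that nonneg \<open>finite T\<close> sum_nonneg_eq_0_iff[of "T - {t}" c] by simp
  then have "(\<Sum>s\<in>T. c s *\<^sub>R s) = t"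
    using \<open>finite T\<close> t \<open>c t = 1\<close> by (simp add: sum.remove)
  then show ?thesis
    using t by simp
qed

lemma zero_in_interior_of_symmetric_convex:
  fixes P :: "'v::euclidean_space set"
  assumes "convex P" and symmetric: "uminus ` P = P" and "span P = UNIV"
  shows "0 \<in> interior P"
proof -
  have "interior P \<noteq> {}"
  proof
    assume "interior P = {}"
    then obtain a b where "a \<noteq> 0" and hyperplane: "P \<subseteq> {x. a \<bullet> x = b}"
      using empty_interior_subset_hyperplane \<open>convex P\<close> by metis
    have "a \<bullet> x = 0" if "x \<in> P" for x
    proof -
      have "- x \<in> P"
        using that symmetric by blast
      then have "a \<bullet> x = b" "- (a \<bullet> x) = b"
        using that hyperplane by auto
      then show ?thesis
        by linarith
    qed
    then have "span P \<subseteq> {x. a \<bullet> x = 0}"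
      by (intro span_minimal subspace_hyperplane) auto
    then have "a \<bullet> a = 0"
      using \<open>span P = UNIV\<close> by blast
    then show False
      using \<open>a \<noteq> 0\<close> by simp
  qed
  then obtain x where x: "x \<in> interior P"
    by blast
  then have "- x \<in> interior P"
    using interior_negations[of P] symmetric by auto
  then show ?thesis
    using x convexD[OF convex_interior[OF \<open>convex P\<close>], of x "- x" "1 / 2" "1 / 2"] by simp
qed

lemma extreme_point_of_perturbation_eq_0:
  fixes u :: "'v::real_vector"
  assumes "u extreme_point_of P" "u + d \<in> P" "u - d \<in> P"
  shows "d = 0"
proof (rule ccontr)
  assume "d \<noteq> 0"
  then have "u - d \<noteq> u + d"
    using eq_minus_self_iff[of d] by auto
  moreover have "midpoint (u - d) (u + d) = u"
    by (simp add: midpoint_def scaleR_2[symmetric])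
  ultimately have "u \<in> open_segment (u - d) (u + d)"
    using midpoint_in_open_segment[of "u - d" "u + d"] by simp
  then show False
    using assms by (auto simp: extreme_point_of_def)
qed

lemma extreme_point_of_halfspaces_tight_span:
  fixes S :: "'v::euclidean_space set"
  assumes "finite S" and extreme: "u extreme_point_of {u. \<forall>s\<in>S. s \<bullet> u \<le> b s}"
  shows "span {s \<in> S. s \<bullet> u = b s} = UNIV"
proof (rule ccontr)
  let ?tight = "{s \<in> S. s \<bullet> u = b s}"
  assume "span ?tight \<noteq> UNIV"
  then obtain d where "d \<noteq> 0" and "\<forall>s\<in>span ?tight. d \<bullet> s = 0"
    using span_not_UNIV_orthogonal by blast
  then have orthogonal: "d \<bullet> s = 0" if "s \<in> ?tight" for s
    using that by (auto intro: span_base)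
  let ?slack = "\<Inter>s\<in>S - ?tight. {y. s \<bullet> y < b s}"
  have "open ?slack"
    using \<open>finite S\<close> by (intro open_INT) (auto simp: open_halfspace_lt)
  moreover have "u \<in> ?slack"
    using extreme by (force simp: extreme_point_of_def)
  ultimately obtain e where "0 < e" and ball: "cball u e \<subseteq> ?slack"
    by (meson open_contains_cball)
  define d' where "d' = (e / norm d) *\<^sub>R d"
  have feasible: "y \<in> {u. \<forall>s\<in>S. s \<bullet> u \<le> b s}" if y: "y = u + d' \<or> y = u - d'" for y
  proof -
    have "y \<in> cball u e"
      using y \<open>d \<noteq> 0\<close> \<open>0 < e\<close> by (auto simp: d'_def dist_norm)
    then have "s \<bullet> y \<le> b s" if "s \<in> S - ?tight" for s
      using ball that by (force intro: less_imp_le)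
    moreover have "s \<bullet> y \<le> b s" if "s \<in> ?tight" for s
      using y that orthogonal[OF that]
      by (auto simp: d'_def inner_add_right inner_diff_right inner_commute[of s d])
    ultimately show ?thesis
      by blast
  qed
  then have "d' = 0"
    using extreme_point_of_perturbation_eq_0[OF extreme] by blast
  then show False
    using \<open>d \<noteq> 0\<close> \<open>0 < e\<close> by (simp add: d'_def)
qed

lemma polar_dual_convex_hull: "polar_dual (convex hull S) = {u. \<forall>s\<in>S. s \<bullet> u \<le> 1}"
proof -
  have "u \<in> polar_dual (convex hull S)" if "\<forall>s\<in>S. s \<bullet> u \<le> 1" for u
  proof -
    have "convex hull S \<subseteq> {x. u \<bullet> x \<le> 1}"
      using that by (intro hull_minimal convex_halfspace_le) (auto simp: inner_commute)
    then show ?thesis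
      by (auto simp: polar_dual_def)
  qed
  then show ?thesis
    by (auto simp: polar_dual_def hull_inc inner_commute)
qed

lemma polyhedron_polar_dual_convex_hull:
  assumes "finite S"
  shows "polyhedron (polar_dual (convex hull S))"
proof -
  have "polar_dual (convex hull S) = \<Inter> ((\<lambda>s. {u. s \<bullet> u \<le> 1}) ` S)"
    by (auto simp: polar_dual_convex_hull)
  then show ?thesis
    using assms polyhedron_halfspace_le by (auto intro!: polyhedron_Inter)
qed

lemma bounded_polar_dual:
  assumes "0 \<in> interior P"
  shows "bounded (polar_dual P)"
proof -
  obtain e where "0 < e" and ball: "cball 0 e \<subseteq> P"
    using assms by (auto simp: mem_interior_cball)
  have "norm u \<le> 1 / e" if u: "u \<in> polar_dual P" for u
  proof (cases "u = 0")
    case False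
    have "(e / norm u) *\<^sub>R u \<in> P"
      using \<open>0 < e\<close> False by (intro subsetD[OF ball]) simp
    then have "u \<bullet> ((e / norm u) *\<^sub>R u) \<le> 1"
      using u unfolding polar_dual_def by blast
    then have "e * norm u \<le> 1"
      using False by (simp add: dot_square_norm power2_eq_square)
    then show ?thesis
      using \<open>0 < e\<close> by (simp add: field_simps)
  qed (use \<open>0 < e\<close> in simp)
  then show ?thesis
    by (auto simp: bounded_iff)
qed

lemma polar_dual_pos_inner:
  assumes "bounded P" "x \<noteq> 0"
  obtains u where "u \<in> polar_dual P" "0 < u \<bullet> x"
proof -
  obtain B where "0 < B" and B: "\<And>y. y \<in> P \<Longrightarrow> norm y \<le> B"
    using \<open>bounded P\<close> by (auto simp: bounded_pos)
  let ?u = "(1 / (B * norm x)) *\<^sub>R x"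
  have "?u \<bullet> y \<le> 1" if "y \<in> P" for y
  proof -
    have "x \<bullet> y \<le> norm x * norm y"
      by (rule norm_cauchy_schwarz)
    also have "\<dots> \<le> norm x * B"
      using B[OF that] by (simp add: mult_left_mono)
    finally show ?thesis
      using \<open>0 < B\<close> \<open>x \<noteq> 0\<close> by (simp add: field_simps)
  qed
  then have "?u \<in> polar_dual P"
    by (simp add: polar_dual_def)
  moreover have "0 < ?u \<bullet> x"
    using \<open>0 < B\<close> \<open>x \<noteq> 0\<close> by simp
  ultimately show thesis
    using that by blast
qed

lemma integer_point_on_polar_facet:
  assumes "bounded P" "lattice_polytope (polar_dual P)"
    and x: "x \<in> P" "x \<in> integer_points" "x \<noteq> 0"
  obtains u where "u \<in> polar_dual P" "u \<bullet> x = 1"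
proof -
  obtain V where "V \<subseteq> integer_points" and V: "polar_dual P = convex hull V"
    using assms(2) by (auto simp: lattice_polytope_def)
  obtain w where "w \<in> convex hull V" "0 < w \<bullet> x"
    using polar_dual_pos_inner[OF \<open>bounded P\<close> \<open>x \<noteq> 0\<close>] V by metis
  have "\<not> convex hull V \<subseteq> {u. x \<bullet> u \<le> 0}"
    using \<open>w \<in> convex hull V\<close> \<open>0 < w \<bullet> x\<close> by (auto simp: inner_commute not_le)
  then have "\<not> V \<subseteq> {u. x \<bullet> u \<le> 0}"
    using hull_minimal[of V _ convex] convex_halfspace_le by blast
  then obtain u where "u \<in> V" "0 < u \<bullet> x"
    by (metis (mono_tags, lifting) subsetI mem_Collect_eq not_le inner_commute)
  moreover from this have "u \<in> polar_dual P"
    by (simp add: V hull_inc)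
  moreover from this have "u \<bullet> x \<le> 1"
    using x by (simp add: polar_dual_def)
  moreover have "u \<bullet> x \<in> \<int>"
    using inner_integer_points \<open>u \<in> V\<close> \<open>V \<subseteq> integer_points\<close> x by blast
  ultimately have "u \<bullet> x = 1"
    using Ints_nonzero_abs_ge1[of "u \<bullet> x"] by simp
  then show thesis
    using that \<open>u \<in> polar_dual P\<close> by blast
qed

section \<open>Symmetric unimodular vector systems\<close>

locale unimodular_system =
  fixes S :: "(real ^ 'r::finite) set"
  assumes finite_system: "finite S"
    and integral_system: "S \<subseteq> integer_points"
    and uminus_closed: "s \<in> S \<Longrightarrow> - s \<in> S"
    and spanning: "span S = UNIV"
    and det_system: "range g \<subseteq> S \<Longrightarrow> det (\<chi> i. g i) \<in> {-1, 0, 1}"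
begin

lemma unimodular_matrix_of_basis:
  assumes "B \<subseteq> S" "independent B" "span B = UNIV"
  obtains A :: "real ^ 'r ^ 'r"
  where "rows A = B" "\<And>i j. A $ i $ j \<in> \<int>" "det A \<in> {-1, 1}"
proof -
  have card: "card B = CARD('r)"
    using assms(2,3) by (metis dim_eq_card_independent dim_span dim_vec_eq vec_dim_card)
  have "finite B"
    using assms(1) finite_system finite_subset by blast
  then obtain g :: "'r \<Rightarrow> real ^ 'r" where "bij_betw g UNIV B"
    using card finite_same_card_bij[of "UNIV :: 'r set" B] by auto
  then have range: "range g = B"
    by (simp add: bij_betw_def)
  have rows: "rows (\<chi> i. g i) = B"
    using range by (auto simp: rows_def row_def vec_lambda_eta)
  then have "rank (\<chi> i. g i) = CARD('r)"
    using card assms(2) by (simp add: row_rank_def dim_eq_card_independent)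
  then have "det (\<chi> i. g i) \<noteq> 0"
    by (simp add: det_eq_0_rank)
  then have "det (\<chi> i. g i) \<in> {-1, 1}"
    using det_system[of g] assms(1) range by simp
  moreover have "(\<chi> i. g i) $ i $ j \<in> \<int>" for i j
    using integral_system assms(1) range by (auto simp: integer_points_def)
  ultimately show thesis
    using that rows by blast
qed

lemma integral_if_inner_integral_on_spanning:
  assumes "B \<subseteq> S" "span B = UNIV" and inner: "\<And>b. b \<in> B \<Longrightarrow> u \<bullet> b \<in> \<int>"
  shows "u \<in> integer_points"
proof -
  obtain B' where B': "B' \<subseteq> B" "independent B'" "B \<subseteq> span B'"
    using maximal_independent_subset by metis
  then have "span B' = UNIV"
    using assms(2) by (metis span_mono span_span top.extremum_uniqueI)
  then obtain A :: "real ^ 'r ^ 'r"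
    where "rows A = B'" and A: "\<And>i j. A $ i $ j \<in> \<int>" "det A \<in> {-1, 1}"
    using unimodular_matrix_of_basis B' assms(1) by (metis subset_trans)
  have "row i A \<in> B" for i
    using \<open>rows A = B'\<close> B'(1) by (auto simp: rows_def)
  then have "(A *v u) $ i \<in> \<int>" for i
    using inner[of "row i A"]
    by (simp add: matrix_vector_mul_component row_def vec_lambda_eta inner_commute)
  then show ?thesis
    using integral_solution_of_unimodular[OF A] by (simp add: integer_points_def)
qed

lemma coordinates_integral:
  assumes "T \<subseteq> S" "independent T" and combination: "(\<Sum>s\<in>T. c s *\<^sub>R s) \<in> integer_points"
    and "t \<in> T"
  shows "c t \<in> \<int>"
proof -
  have "finite T"
    using \<open>T \<subseteq> S\<close> finite_system finite_subset by blast
  obtain B where B: "T \<subseteq> B" "B \<subseteq> S" "independent B" "S \<subseteq> span B"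
    using maximal_independent_subset_extend \<open>T \<subseteq> S\<close> \<open>independent T\<close> by metis
  then have "span B = UNIV"
    using spanning by (metis span_mono span_span top.extremum_uniqueI)
  obtain h where "linear h" and h_basis: "\<forall>b\<in>B. h b = (if b = t then 1 else 0 :: real)"
    using linear_independent_extend[OF B(3), of "\<lambda>b. if b = t then 1 else 0"] by blast
  \<comment> \<open>the dual basis vector of \<open>t\<close>\<close>
  define u where "u = adjoint h 1"
  have dual: "u \<bullet> b = (if b = t then 1 else 0)" if "b \<in> B" for b
    using h_basis that adjoint_works[OF \<open>linear h\<close>, of b 1] by (simp add: u_def inner_commute[of _ b])
  have "u \<in> integer_points"
    using dual by (intro integral_if_inner_integral_on_spanning[OF B(2) \<open>span B = UNIV\<close>]) simp
  then have "u \<bullet> (\<Sum>s\<in>T. c s *\<^sub>R s) \<in> \<int>"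
    using combination by (rule inner_integer_points)
  moreover have "u \<bullet> (\<Sum>s\<in>T. c s *\<^sub>R s) = (\<Sum>s\<in>T. if s = t then c s else 0)"
    using dual B(1) by (auto simp: inner_sum_right intro!: sum.cong)
  ultimately show ?thesis
    using \<open>finite T\<close> \<open>t \<in> T\<close> by simp
qed

lemma parallel_imp_eq_or_minus:
  assumes "v \<in> S" "w \<in> S" "v \<noteq> 0" "v = k *\<^sub>R w"
  shows "v = w \<or> v = - w"
proof -
  have "w \<noteq> 0" "k \<noteq> 0"
    using assms by auto
  have "k \<in> \<int>"
    using coordinates_integral[of "{w}" "\<lambda>_. k" w] assms integral_system \<open>w \<noteq> 0\<close> by auto
  moreover have "1 / k \<in> \<int>"
    using coordinates_integral[of "{v}" "\<lambda>_. 1 / k" v] assms integral_system \<open>k \<noteq> 0\<close> by auto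
  ultimately have "\<bar>k\<bar> \<ge> 1" "\<bar>1 / k\<bar> \<ge> 1"
    using Ints_nonzero_abs_ge1[of k] Ints_nonzero_abs_ge1[of "1 / k"] \<open>k \<noteq> 0\<close> by simp_all
  then have "\<bar>k\<bar> = 1"
    by (simp add: abs_divide divide_simps split: if_splits)
  then show ?thesis
    using assms(4) by (auto simp: abs_if split: if_splits)
qed

lemma independent_pair_iff_not_antipodal:
  assumes "v \<in> S" "w \<in> S" "v \<noteq> 0" "w \<noteq> 0" "v \<noteq> w"
  shows "independent {v, w} \<longleftrightarrow> v \<noteq> - w"
proof -
  have "v = - w \<longleftrightarrow> (\<exists>k. v = k *\<^sub>R w)"
    using parallel_imp_eq_or_minus[of v w] assms by (metis scaleR_minus1_left)
  then show ?thesis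
    using independent_pair_iff[OF \<open>v \<noteq> w\<close>] \<open>w \<noteq> 0\<close> by blast
qed

lemma uminus_convex_hull: "uminus ` (convex hull S) = convex hull S"
proof -
  have "uminus ` S = S"
    using uminus_closed by force
  then show ?thesis
    by (metis convex_hull_linear_image linear_uminus)
qed

lemma zero_in_interior_convex_hull: "0 \<in> interior (convex hull S)"
proof (rule zero_in_interior_of_symmetric_convex)
  show "span (convex hull S) = UNIV"
    using spanning span_mono[OF hull_subset[of S convex]] by blast
qed (simp_all add: uminus_convex_hull)

lemma aff_dim_convex_hull: "aff_dim (convex hull S) = int CARD('r)"
  using aff_dim_nonempty_interior[of "convex hull S"] zero_in_interior_convex_hull by auto

lemma lattice_polytope_polar_dual: "lattice_polytope (polar_dual (convex hull S))"
proof -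
  let ?Q = "polar_dual (convex hull S)"
  have polyhedron: "polyhedron ?Q"
    using finite_system by (rule polyhedron_polar_dual_convex_hull)
  then have "compact ?Q" "convex ?Q"
    using bounded_polar_dual[OF zero_in_interior_convex_hull]
    by (auto simp: compact_eq_bounded_closed polyhedron_imp_closed polyhedron_imp_convex)
  then have "?Q = convex hull {u. u extreme_point_of ?Q}"
    by (rule Krein_Milman_Minkowski)
  moreover have "u \<in> integer_points" if "u extreme_point_of ?Q" for u
  proof (rule integral_if_inner_integral_on_spanning)
    show "span {s \<in> S. s \<bullet> u = 1} = UNIV"
      using that finite_system
      by (intro extreme_point_of_halfspaces_tight_span) (simp_all add: polar_dual_convex_hull)
  qed (auto simp: inner_commute)
  ultimately show ?thesis
    unfolding lattice_polytope_def using finite_polyhedron_extreme_points[OF polyhedron] by blast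
qed

lemma reflexive_convex_hull: "reflexive_polytope (convex hull S)"
  unfolding reflexive_polytope_def
  using aff_dim_convex_hull zero_in_interior_convex_hull lattice_polytope_polar_dual
    finite_system integral_system
  by (auto simp: lattice_polytope_def[of "convex hull S"])

lemma integer_point_of_convex_hull:
  assumes "W \<subseteq> S" and x: "x \<in> convex hull W" "x \<in> integer_points" "x \<noteq> 0"
  shows "x \<in> W"
proof -
  have "bounded (convex hull S)"
    using finite_system by (simp add: bounded_convex_hull finite_imp_bounded)
  moreover have "x \<in> convex hull S"
    using x(1) hull_mono[OF \<open>W \<subseteq> S\<close>] by blast
  ultimately obtain u where "u \<in> polar_dual (convex hull S)" "u \<bullet> x = 1"
    using integer_point_on_polar_facet[OF _ lattice_polytope_polar_dual] x(2,3) by metis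
  moreover have "compact W"
    using \<open>W \<subseteq> S\<close> finite_system finite_imp_compact finite_subset by blast
  ultimately have "x \<in> convex hull {w \<in> W. u \<bullet> w = 1}"
    using x(1) \<open>W \<subseteq> S\<close>
    by (intro convex_hull_Int_supporting_hyperplane)
      (auto simp: polar_dual_convex_hull inner_commute)
  then obtain T where T_subset: "T \<subseteq> {w \<in> W. u \<bullet> w = 1}"
    and T_independent: "\<not> affine_dependent T" and x_in_hull: "x \<in> convex hull T"
    by (rule convex_hull_Caratheodory_affine_independent)
  have "finite T"
    using T_independent by (rule aff_independent_finite)
  then obtain c where coeffs: "\<And>t. t \<in> T \<Longrightarrow> 0 \<le> c t" "sum c T = 1" "x = (\<Sum>t\<in>T. c t *\<^sub>R t)"
    using x_in_hull by (auto simp: convex_hull_finite)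
  have "independent T"
    using T_subset T_independent by (intro affine_independent_in_hyperplane_imp_independent[of T u 1]) auto
  then have "c t \<in> \<int>" if "t \<in> T" for t
    using coordinates_integral[of T c t] T_subset \<open>W \<subseteq> S\<close> coeffs(3) x(2) that by auto
  then have "x \<in> T"
    unfolding coeffs(3) using \<open>finite T\<close> coeffs(1,2) by (intro integral_convex_combination_in_set)
  then show ?thesis
    using T_subset by blast
qed

lemma vertices_convex_hull: "polytope_vertices (convex hull S) = S - {0}"
proof (intro equalityI subsetI)
  fix v assume v: "v \<in> polytope_vertices (convex hull S)"
  then have "v \<in> S"
    by (simp add: polytope_vertices_def extreme_point_of_convex_hull)
  moreover have "v \<noteq> 0"
    using v zero_in_interior_convex_hull extreme_point_not_in_interior
    by (fastforce simp: polytope_vertices_def)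
  ultimately show "v \<in> S - {0}"
    by simp
next
  let ?V = "{v. v extreme_point_of convex hull S}"
  fix v assume v: "v \<in> S - {0}"
  then have "v \<in> convex hull ?V"
    using Krein_Milman_polytope[OF finite_system] hull_inc[of v S convex] by auto
  then show "v \<in> polytope_vertices (convex hull S)"
    using integer_point_of_convex_hull[of ?V v] v integral_system extreme_points_of_convex_hull[of S]
    by (auto simp: polytope_vertices_def)
qed

lemma terminal_convex_hull: "terminal_polytope (convex hull S)"
  unfolding terminal_polytope_def vertices_convex_hull
proof (intro equalityI subsetI)
  fix x assume "x \<in> convex hull S \<inter> integer_points"
  then show "x \<in> insert 0 (S - {0})"
    using integer_point_of_convex_hull[of S x] by auto
next
  fix x assume "x \<in> insert 0 (S - {0})"
  then show "x \<in> convex hull S \<inter> integer_points"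
    using zero_in_interior_convex_hull interior_subset integral_system hull_inc[of x S convex]
    by (auto simp: integer_points_def)
qed

lemma card_vertices_convex_hull:
  "card (polytope_vertices (convex hull S)) =
    2 * card {{v, - v} |v. v \<in> polytope_vertices (convex hull S)}"
  unfolding vertices_convex_hull
  using finite_system uminus_closed by (intro card_eq_twice_card_antipodal_pairs) auto

end

section \<open>Columns of weakly unimodular matrices\<close>

lemma columns_eq_range: "columns A = range (\<lambda>j. column j A)"
  by (auto simp: columns_def)

lemma column_sym_matrix [simp]:
  "column (Inl k) (real_matrix (sym_matrix M)) = column k (real_matrix M)"
  "column (Inr k) (real_matrix (sym_matrix M)) = - column k (real_matrix M)"
  by (simp_all add: column_def sym_matrix_def map_matrix_def vec_eq_iff)

lemma columns_sym_matrix: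
  "columns (real_matrix (sym_matrix M)) =
    (\<Union>k. {column k (real_matrix M), - column k (real_matrix M)})"
  unfolding columns_eq_range UNIV_sum image_Un image_image by auto

lemma det_columns_weakly_unimodular:
  fixes M :: "int ^ 'n::finite ^ 'r::finite"
  assumes "full_rank_weakly_unimodular M"
  shows "det (\<chi> i. column (f i) (real_matrix M)) \<in> {-1, 0, 1}"
proof (cases "inj f")
  case True
  have "(\<chi> i. column (f i) (real_matrix M)) = transpose (real_matrix (\<chi> i j. M $ i $ f j))"
    by (simp add: vec_eq_iff transpose_def column_def map_matrix_def)
  then have "det (\<chi> i. column (f i) (real_matrix M)) = real_of_int (det (\<chi> i j. M $ i $ f j))"
    by (simp only: det_transpose det_map_matrix_of_int)
  moreover have "det (\<chi> i j. M $ i $ f j) \<in> {-1, 0, 1}"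
    using assms True by (simp add: full_rank_weakly_unimodular_def)
  ultimately show ?thesis
    by auto
next
  case False
  then obtain i j where "i \<noteq> j" "f i = f j"
    by (auto simp: inj_def)
  then have "det (\<chi> i. column (f i) (real_matrix M)) = 0"
    by (intro det_identical_rows[of i j]) (auto simp: row_def)
  then show ?thesis
    by simp
qed

lemma unimodular_system_columns:
  fixes M :: "int ^ 'n::finite ^ 'r::finite"
  assumes M: "full_rank_weakly_unimodular M"
  shows "unimodular_system (columns (real_matrix (sym_matrix M)))"
proof
  let ?S = "columns (real_matrix (sym_matrix M))"
  show "finite ?S"
    by (simp add: columns_sym_matrix)
  show "?S \<subseteq> integer_points"
    unfolding columns_sym_matrix by (auto simp: integer_points_def column_def map_matrix_def)
  show "- s \<in> ?S" if "s \<in> ?S" for s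
    using that by (auto simp: columns_sym_matrix)
  have "dim (columns (real_matrix M)) = CARD('r)"
    using M by (simp add: full_rank_weakly_unimodular_def column_rank_def)
  then have "span (columns (real_matrix M)) = UNIV"
    using dim_eq_full[of "columns (real_matrix M)"] by simp
  moreover have "columns (real_matrix M) \<subseteq> ?S"
    unfolding columns_sym_matrix by (auto simp: columns_def)
  ultimately show "span ?S = UNIV"
    using span_mono by blast
  show "det (\<chi> i. g i) \<in> {-1, 0, 1}" if "range g \<subseteq> ?S" for g :: "'r \<Rightarrow> real ^ 'r"
  proof -
    have "\<exists>k. g i = column k (real_matrix M) \<or> g i = - column k (real_matrix M)" for i
      using that by (auto simp: columns_sym_matrix image_subset_iff)
    then obtain f where
      "g i = column (f i) (real_matrix M) \<or> g i = - column (f i) (real_matrix M)" for i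
      by metis
    from det_rows_up_to_sign[of g, OF this] show ?thesis
      using det_columns_weakly_unimodular[OF M, of f] by auto
  qed
qed

section \<open>Atoms of the lattice of flats\<close>

context matroid
begin

lemma finite_indep_subsets: "finite {Y \<in> I. Y \<subseteq> X}"
  by (rule finite_subset[of _ "Pow E"]) (auto simp: finite_ground dest: indep_subset_ground)

lemma le_matroid_rank_iff: "n \<le> matroid_rank I X \<longleftrightarrow> (\<exists>Y\<in>I. Y \<subseteq> X \<and> card Y = n)"
proof -
  have "n \<le> matroid_rank I X \<longleftrightarrow> (\<exists>Y\<in>I. Y \<subseteq> X \<and> n \<le> card Y)"
    unfolding matroid_rank_def using finite_indep_subsets[of X] indep_empty
    by (subst Max_ge_iff) auto
  also have "\<dots> \<longleftrightarrow> (\<exists>Y\<in>I. Y \<subseteq> X \<and> card Y = n)"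
    by (metis indep_mono obtain_subset_with_card_n order_refl order_trans)
  finally show ?thesis .
qed

lemma matroid_rank_ge_1_iff: "1 \<le> matroid_rank I X \<longleftrightarrow> (\<exists>a\<in>X. {a} \<in> I)"
  unfolding le_matroid_rank_iff by (auto simp: card_1_singleton_iff)

lemma matroid_rank_ge_2_iff:
  "2 \<le> matroid_rank I X \<longleftrightarrow> (\<exists>a\<in>X. \<exists>b\<in>X. a \<noteq> b \<and> {a, b} \<in> I)"
  unfolding le_matroid_rank_iff by (auto simp: card_2_iff) (metis empty_subsetI insert_subset)

text \<open>This includes the loops: \<open>{a, b}\<close> is dependent whenever \<open>b\<close> is a loop.\<close>

definition parallel_closure :: "'a \<Rightarrow> 'a set" where
  "parallel_closure a = {b \<in> E. b = a \<or> {a, b} \<notin> I}"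

lemma mem_parallel_closure_self: "{a} \<in> I \<Longrightarrow> a \<in> parallel_closure a"
  using indep_subset_ground by (auto simp: parallel_closure_def)

lemma parallel_closure_pair_dependent:
  assumes "{a} \<in> I" "b \<in> parallel_closure a" "c \<in> parallel_closure a" "b \<noteq> c"
  shows "{b, c} \<notin> I"
proof
  assume "{b, c} \<in> I"
  then obtain y where "y \<in> {b, c} - {a}" "{y, a} \<in> I"
    using indep_exchange[OF \<open>{a} \<in> I\<close>] \<open>b \<noteq> c\<close> by fastforce
  then show False
    using assms(2,3) by (auto simp: parallel_closure_def insert_commute)
qed

lemma parallel_closure_eq_iff:
  assumes "{a} \<in> I" "{b} \<in> I"
  shows "parallel_closure a = parallel_closure b \<longleftrightarrow> a = b \<or> {a, b} \<notin> I"
proof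
  assume "parallel_closure a = parallel_closure b"
  then have "b \<in> parallel_closure a"
    using assms(2) mem_parallel_closure_self by blast
  then show "a = b \<or> {a, b} \<notin> I"
    by (auto simp: parallel_closure_def)
next
  have subset: "parallel_closure a \<subseteq> parallel_closure b"
    if "{a} \<in> I" "{b} \<in> I" "a = b \<or> {a, b} \<notin> I" for a b
  proof
    fix c assume c: "c \<in> parallel_closure a"
    have "b \<in> parallel_closure a"
      using that indep_subset_ground by (auto simp: parallel_closure_def)
    then show "c \<in> parallel_closure b"
      using c parallel_closure_pair_dependent[OF \<open>{a} \<in> I\<close>, of b c]
      by (auto simp: parallel_closure_def)
  qed
  assume "a = b \<or> {a, b} \<notin> I"
  then show "parallel_closure a = parallel_closure b"
    using subset[of a b] subset[of b a] assms by (auto simp: insert_commute)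
qed

lemma parallel_closure_in_flat_atoms:
  assumes "{a} \<in> I"
  shows "parallel_closure a \<in> flat_atoms E I"
proof -
  have mem: "a \<in> parallel_closure a"
    using assms by (rule mem_parallel_closure_self)
  then have "1 \<le> matroid_rank I (parallel_closure a)"
    using assms unfolding matroid_rank_ge_1_iff by blast
  moreover have "\<not> 2 \<le> matroid_rank I (parallel_closure a)"
    using parallel_closure_pair_dependent[OF assms] by (auto simp: matroid_rank_ge_2_iff)
  ultimately have rank: "matroid_rank I (parallel_closure a) = 1"
    by linarith
  have "2 \<le> matroid_rank I (insert x (parallel_closure a))" if "x \<in> E - parallel_closure a" for x
  proof -
    have "a \<noteq> x" "{a, x} \<in> I"
      using that by (auto simp: parallel_closure_def)
    then show ?thesis
      unfolding matroid_rank_ge_2_iff using mem by blast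
  qed
  then have "flat E I (parallel_closure a)"
    using rank by (force simp: flat_def parallel_closure_def)
  then show ?thesis
    using rank by (simp add: flat_atoms_def)
qed

lemma flat_atom_eq_parallel_closure:
  assumes "F \<in> flat_atoms E I" "a \<in> F" "{a} \<in> I"
  shows "F = parallel_closure a"
proof (intro equalityI subsetI)
  have F: "F \<subseteq> E" "matroid_rank I F = 1"
    "\<And>x. x \<in> E - F \<Longrightarrow> 2 \<le> matroid_rank I (insert x F)"
    using assms(1) by (auto simp: flat_atoms_def flat_def Suc_le_eq numeral_2_eq_2)
  show F_subset: "b \<in> parallel_closure a" if "b \<in> F" for b
  proof -
    have "\<not> (a \<noteq> b \<and> {a, b} \<in> I)"
      using F(2) matroid_rank_ge_2_iff[of F] \<open>a \<in> F\<close> that by auto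
    then show ?thesis
      using F(1) that by (auto simp: parallel_closure_def)
  qed
  show "x \<in> F" if x: "x \<in> parallel_closure a" for x
  proof (rule ccontr)
    assume "x \<notin> F"
    then have "2 \<le> matroid_rank I (insert x F)"
      using F(3) x by (auto simp: parallel_closure_def)
    then obtain b c where "b \<in> insert x F" "c \<in> insert x F" "b \<noteq> c" "{b, c} \<in> I"
      unfolding matroid_rank_ge_2_iff by blast
    then show False
      using parallel_closure_pair_dependent[OF \<open>{a} \<in> I\<close>] F_subset x by blast
  qed
qed

lemma flat_atoms_eq: "flat_atoms E I = parallel_closure ` {a. {a} \<in> I}"
proof (intro equalityI subsetI)
  fix F assume F: "F \<in> flat_atoms E I"
  then obtain a where "a \<in> F" "{a} \<in> I"
    using matroid_rank_ge_1_iff[of F] by (auto simp: flat_atoms_def)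
  then show "F \<in> parallel_closure ` {a. {a} \<in> I}"
    using flat_atom_eq_parallel_closure[OF F] by blast
qed (use parallel_closure_in_flat_atoms in blast)

lemma simple_matroid_indep_pair:
  assumes "simple_matroid E I" "a \<in> E" "b \<in> E"
  shows "{a, b} \<in> I"
proof -
  have "{a} \<in> I" "{b} \<in> I"
    using assms by (auto simp: simple_matroid_def matroid_loop_def)
  then show ?thesis
    using assms by (cases "a = b") (auto simp: simple_matroid_def matroid_parallel_def)
qed

end

section \<open>Vertices and atoms\<close>

locale unimodular_representation = matroid E I
  for E :: "'a set" and I :: "'a set set" +
  fixes M :: "int ^ 'n::finite ^ 'r::finite" and \<phi> :: "'a \<Rightarrow> 'n"
  assumes unimodular: "full_rank_weakly_unimodular M"
    and isomorphism: "matroid_isomorphism \<phi> E I UNIV (column_indep M)"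
begin

sublocale unimodular_system "columns (real_matrix (sym_matrix M))"
  using unimodular by (rule unimodular_system_columns)

abbreviation rep :: "'a \<Rightarrow> real ^ 'r" where
  "rep e \<equiv> column (\<phi> e) (real_matrix M)"

lemma bij_betw_ground: "bij_betw \<phi> E UNIV"
  using isomorphism by (simp add: matroid_isomorphism_def)

lemma indep_iff:
  assumes "X \<subseteq> E"
  shows "X \<in> I \<longleftrightarrow> inj_on rep X \<and> independent (rep ` X)"
proof -
  have "X \<in> I \<longleftrightarrow> \<phi> ` X \<in> column_indep M"
    using isomorphism assms by (simp add: matroid_isomorphism_def)
  moreover have "inj_on \<phi> X"
    using bij_betw_ground assms by (auto simp: bij_betw_def inj_on_subset)
  ultimately show ?thesis
    by (simp add: column_indep_def comp_inj_on_iff comp_def image_image)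
qed

lemma indep_singleton_iff: "{a} \<in> I \<longleftrightarrow> a \<in> E \<and> rep a \<noteq> 0"
  using indep_iff[of "{a}"] indep_subset_ground by auto

lemma antipodal_pairs_rep_eq_iff:
  assumes "{a} \<in> I" "{b} \<in> I"
  shows "{rep a, - rep a} = {rep b, - rep b} \<longleftrightarrow> a = b \<or> {a, b} \<notin> I"
proof (cases "a = b")
  case False
  have "rep a \<in> columns (real_matrix (sym_matrix M))" "rep b \<in> columns (real_matrix (sym_matrix M))"
    by (auto simp: columns_sym_matrix)
  then have "independent {rep a, rep b} \<longleftrightarrow> rep a \<noteq> - rep b" if "rep a \<noteq> rep b"
    using that assms by (intro independent_pair_iff_not_antipodal) (auto simp: indep_singleton_iff)
  moreover have "{a, b} \<in> I \<longleftrightarrow> rep a \<noteq> rep b \<and> independent {rep a, rep b}"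
    using indep_iff[of "{a, b}"] assms False by (auto simp: indep_singleton_iff)
  ultimately show ?thesis
    using False unfolding antipodal_pair_eq_iff by blast
qed simp

lemma vertices_sym_edge_polytope:
  "polytope_vertices (sym_edge_polytope M) = (\<Union>e\<in>{e. {e} \<in> I}. {rep e, - rep e})"
proof -
  have "columns (real_matrix (sym_matrix M)) = (\<Union>e\<in>E. {rep e, - rep e})"
    unfolding columns_sym_matrix bij_betw_imp_surj_on[OF bij_betw_ground, symmetric] by simp
  then show ?thesis
    unfolding sym_edge_polytope_def vertices_convex_hull by (auto simp: indep_singleton_iff)
qed

lemma antipodal_pairs_of_vertices:
  "{{v, - v} |v. v \<in> polytope_vertices (sym_edge_polytope M)} =
    (\<lambda>e. {rep e, - rep e}) ` {e. {e} \<in> I}"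
  unfolding vertices_sym_edge_polytope by (auto simp: insert_commute)

lemma card_vertices_sym_edge_polytope:
  "card (polytope_vertices (sym_edge_polytope M)) =
    2 * card {{v, - v} |v. v \<in> polytope_vertices (sym_edge_polytope M)}"
  unfolding sym_edge_polytope_def by (rule card_vertices_convex_hull)

lemma card_vertices_eq_twice_card_flat_atoms:
  "card (polytope_vertices (sym_edge_polytope M)) = 2 * card (flat_atoms E I)"
proof -
  have "card ((\<lambda>e. {rep e, - rep e}) ` {e. {e} \<in> I}) = card (parallel_closure ` {e. {e} \<in> I})"
    by (intro card_image_eq_of_same_kernel)
      (simp add: antipodal_pairs_rep_eq_iff parallel_closure_eq_iff)
  then show ?thesis
    unfolding card_vertices_sym_edge_polytope antipodal_pairs_of_vertices flat_atoms_eq by simp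
qed

lemma bij_betw_antipodal_pairs_of_vertices:
  assumes "simple_matroid E I"
  shows "bij_betw (\<lambda>e. {rep e, - rep e}) E
    {{v, - v} |v. v \<in> polytope_vertices (sym_edge_polytope M)}"
proof -
  have nonloop: "{a} \<in> I \<longleftrightarrow> a \<in> E" for a
    using simple_matroid_indep_pair[OF assms, of a a] indep_subset_ground by auto
  have "inj_on (\<lambda>e. {rep e, - rep e}) E"
  proof (rule inj_onI)
    fix a b assume "a \<in> E" "b \<in> E" "{rep a, - rep a} = {rep b, - rep b}"
    then show "a = b"
      using antipodal_pairs_rep_eq_iff[of a b] simple_matroid_indep_pair[OF assms, of a b] nonloop
      by blast
  qed
  then show ?thesis
    unfolding antipodal_pairs_of_vertices by (simp add: bij_betw_def nonloop)
qed

lemma bij_betw_columns_vertices: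
  assumes "simple_matroid E I"
  shows "bij_betw (\<lambda>j. column j (real_matrix (sym_matrix M))) UNIV
    (polytope_vertices (sym_edge_polytope M))"
proof -
  have "rep e \<noteq> 0" if "e \<in> E" for e
    using simple_matroid_indep_pair[OF assms that that] by (simp add: indep_singleton_iff)
  then have "column k (real_matrix M) \<noteq> 0" for k
    using bij_betw_ground by (metis UNIV_I bij_betw_iff_bijections)
  then have range: "range (\<lambda>j. column j (real_matrix (sym_matrix M))) =
      polytope_vertices (sym_edge_polytope M)"
    unfolding sym_edge_polytope_def vertices_convex_hull columns_eq_range[symmetric]
    by (auto simp: columns_sym_matrix)
  \<comment> \<open>the columns are distinct because there are \<open>2n\<close> vertices\<close>
  have "card (polytope_vertices (sym_edge_polytope M)) = 2 * card E"
    unfolding card_vertices_sym_edge_polytope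
    using bij_betw_same_card[OF bij_betw_antipodal_pairs_of_vertices[OF assms]] by simp
  also have "\<dots> = CARD('n + 'n)"
    using bij_betw_same_card[OF bij_betw_ground] by simp
  finally have "inj (\<lambda>j. column j (real_matrix (sym_matrix M)))"
    unfolding range[symmetric] by (intro eq_card_imp_inj_on) simp_all
  then show ?thesis
    using range by (simp add: bij_betw_def)
qed

end

theorem theorem4p3:
  fixes E :: "'a set" and I :: "'a set set" and M :: "int ^ 'n::finite ^ 'r::finite"
  assumes "regular_matroid TYPE('r) TYPE('n) E I"
    and "matroid_rank I E = CARD('r)"
    and "card E = CARD('n)"
    and "full_rank_weakly_unimodular M"
    and "represents M E I"
  shows "centrally_symmetric (sym_edge_polytope M)
    \<and> aff_dim (sym_edge_polytope M) = int (matroid_rank I E)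
    \<and> reflexive_polytope (sym_edge_polytope M)
    \<and> terminal_polytope (sym_edge_polytope M)
    \<and> card (polytope_vertices (sym_edge_polytope M)) = 2 * card (flat_atoms E I)
    \<and> (simple_matroid E I \<longrightarrow>
         bij_betw (\<lambda>j. column j (real_matrix (sym_matrix M))) UNIV
           (polytope_vertices (sym_edge_polytope M))
         \<and> (\<forall>\<phi>. matroid_isomorphism \<phi> E I UNIV (column_indep M) \<longrightarrow>
              bij_betw (\<lambda>e. {column (\<phi> e) (real_matrix M), - column (\<phi> e) (real_matrix M)}) E
                {{v, - v} |v. v \<in> polytope_vertices (sym_edge_polytope M)}))"
proof -
  let ?P = "sym_edge_polytope M"
  have representation: "unimodular_representation E I M \<psi>"
    if "matroid_isomorphism \<psi> E I UNIV (column_indep M)" for \<psi>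
    using assms(1,4) that
    by (simp add: regular_matroid_def unimodular_representation_def
        unimodular_representation_axioms_def)
  obtain \<phi> where "matroid_isomorphism \<phi> E I UNIV (column_indep M)"
    using assms(5) by (auto simp: represents_def)
  then interpret unimodular_representation E I M \<phi>
    by (rule representation)
  have "centrally_symmetric ?P"
    unfolding centrally_symmetric_def sym_edge_polytope_def by (rule uminus_convex_hull)
  moreover have "aff_dim ?P = int (matroid_rank I E)"
    unfolding sym_edge_polytope_def assms(2) by (rule aff_dim_convex_hull)
  moreover have "reflexive_polytope ?P" "terminal_polytope ?P"
    unfolding sym_edge_polytope_def by (rule reflexive_convex_hull terminal_convex_hull)+
  moreover note card_vertices_eq_twice_card_flat_atoms bij_betw_columns_vertices
    unimodular_representation.bij_betw_antipodal_pairs_of_vertices[OF representation]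
  ultimately show ?thesis
    by blast
qed

end
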